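(* Let $n\ge 2$, let $f_0,f_1,\dots,f_m\in\mathbb{R}[x_1,\dots,x_n]$ be polynomials and let $b_1,\dots,b_m\in\mathbb{R}$. Consider the generalized problem of moments on the sphere $$val:=\inf_{\nu\in\mathcal{M}(\mathbb{S}^{n-1})_+}\left\{\int_{\mathbb{S}^{n-1}}f_0(x)\,d\nu(x)\;:\;\int_{\mathbb{S}^{n-1}}f_i(x)\,d\nu(x)=b_i\quad\forall i\in[m]\right\},$$ and assume that it has an optimal solution (i.e., the infimum is attained by some feasible $\nu$). Then for any integer $r\ge 1$ there is an $h_r\in\Sigma[x]_r$ such that $$\left|\int_{\mathbb{S}^{n-1}}f_0(x)h_r(x)\,d\sigma(x)-val\right|=O(1/r),\qquad \left|\int_{\mathbb{S}^{n-1}}f_i(x)h_r(x)\,d\sigma(x)-b_i\right|=O(1/r)\quad\forall i\in[m],$$ that is, there is a constant $C>0$, independent of $r$, such that for every integer $r\ge1$ there is such an $h_r$ for which all these $m+1$ quantities are at most $C/r$.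
   Context: $\mathbb{S}^{n-1}=\{x\in\mathbb{R}^n:\|x\|=1\}$ is the Euclidean unit sphere and $\sigma$ is its (unnormalized) surface measure. $\mathcal{M}(\mathbb{S}^{n-1})_+$ is the convex cone of (finite) positive Borel measures supported on $\mathbb{S}^{n-1}$. $[m]=\{1,\dots,m\}$. $\Sigma[x]_r$ is the set of sums of squares of real polynomials in $x=(x_1,\dots,x_n)$ having degree at most $2r$. *)

theory Defs
  imports "HOL-Analysis.Analysis" "HOL-Library.Poly_Mapping"
begin

text \<open>
  A polynomial in the coordinates of \<open>real ^ 'n\<close> is a finitely supported map from exponent
  vectors to coefficients; sums and products are those of \<^theory>\<open>HOL-Library.Poly_Mapping\<close>
  (convolution).
\<close>

type_synonym 'n mpoly = "('n \<Rightarrow>\<^sub>0 nat) \<Rightarrow>\<^sub>0 real"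

definition peval :: "'n::finite mpoly \<Rightarrow> real ^ 'n \<Rightarrow> real" where
  "peval p x = (\<Sum>a\<in>Poly_Mapping.keys p. Poly_Mapping.lookup p a * (\<Prod>i\<in>UNIV. (x $ i) ^ Poly_Mapping.lookup a i))"

text \<open>The zero polynomial gets total degree 0.\<close>

definition total_degree :: "'n::finite mpoly \<Rightarrow> nat" where
  "total_degree p = Max (insert 0 ((\<lambda>a. \<Sum>i\<in>UNIV. Poly_Mapping.lookup a i) ` Poly_Mapping.keys p))"

definition sos :: "nat \<Rightarrow> 'n::finite mpoly set" where
  "sos r = {h. (\<exists>qs. h = (\<Sum>q\<leftarrow>qs. q * q)) \<and> total_degree h \<le> 2 * r}"

text \<open>
  Unnormalized surface measure of the unit sphere: \<open>DIM('a)\<close> times the image of Lebesgue measure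
  on the punctured open unit ball under radial projection \<open>x \<mapsto> x / norm x\<close>.  So the surface
  measure of a Borel set \<open>A\<close> is \<open>DIM('a)\<close> times the volume of the cone over \<open>A\<close>
  (lemma \<open>emeasure_sphere_measure\<close>), in accordance with integration in polar coordinates.
\<close>

definition sphere_measure :: "'a::euclidean_space measure" where
  "sphere_measure = scale_measure (of_nat DIM('a))
     (distr (restrict_space lborel (ball 0 1 - {0})) (restrict_space borel (sphere 0 1)) sgn)"

lemma space_sphere_measure: "space (sphere_measure :: 'a::euclidean_space measure) = sphere 0 1"
proof -
  have "space sphere_measure = space (restrict_space borel (sphere (0::'a) 1))"
    by (rule sets_eq_imp_space_eq) (simp add: sphere_measure_def)
  then show ?thesis by (simp add: space_restrict_space)
qed

lemma sets_sphere_measure: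
  "sets (sphere_measure :: 'a::euclidean_space measure) = sets (restrict_space borel (sphere 0 1))"
  by (simp add: sphere_measure_def)

lemma emeasure_sphere_measure:
  fixes A :: "'a::euclidean_space set"
  assumes "A \<in> sets borel" "A \<subseteq> sphere 0 1"
  shows "emeasure sphere_measure A =
    of_nat DIM('a) * emeasure lborel {t *\<^sub>R a | t a. 0 < t \<and> t < 1 \<and> a \<in> A}"
proof -
  have A: "A \<in> sets (restrict_space borel (sphere 0 1))"
    using assms by (auto simp: sets_restrict_space)
  have meas: "sgn \<in> restrict_space lborel (ball 0 1 - {0}) \<rightarrow>\<^sub>M
      restrict_space borel (sphere (0::'a) 1)"
  proof (rule measurable_restrict_space2)
    show "sgn \<in> space (restrict_space lborel (ball 0 1 - {0})) \<rightarrow> sphere (0::'a) 1"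
      by (auto simp: space_restrict_space norm_sgn)
    show "sgn \<in> restrict_space lborel (ball 0 1 - {0}) \<rightarrow>\<^sub>M (borel :: 'a measure)"
      unfolding sgn_div_norm by (intro measurable_restrict_space1) measurable
  qed
  have *: "sgn -` A \<inter> (ball 0 1 - {0}) = {t *\<^sub>R a | t a. 0 < t \<and> t < 1 \<and> a \<in> A}"
  proof (intro equalityI subsetI)
    fix x assume x: "x \<in> sgn -` A \<inter> (ball 0 1 - {0})"
    then have "x = norm x *\<^sub>R sgn x" "0 < norm x" "norm x < 1" "sgn x \<in> A"
      by (auto simp: sgn_div_norm)
    then show "x \<in> {t *\<^sub>R a | t a. 0 < t \<and> t < 1 \<and> a \<in> A}" by blast
  next
    fix x assume "x \<in> {t *\<^sub>R a | t a. 0 < t \<and> t < 1 \<and> a \<in> A}"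
    then obtain t a where ta: "x = t *\<^sub>R a" "0 < t" "t < 1" "a \<in> A" by blast
    with assms have "norm a = 1" by auto
    with ta show "x \<in> sgn -` A \<inter> (ball 0 1 - {0})"
      by (auto simp: sgn_div_norm)
  qed
  have "emeasure (restrict_space lborel (ball 0 1 - {0})) (sgn -` A \<inter> (ball 0 1 - {0})) =
      emeasure lborel (sgn -` A \<inter> (ball 0 1 - {0}))"
    by (rule emeasure_restrict_space) auto
  then show ?thesis
    by (simp add: sphere_measure_def emeasure_distr[OF meas A] space_restrict_space *)
qed

definition sphere_measures :: "'a::euclidean_space measure set" where
  "sphere_measures = {\<nu>. sets \<nu> = sets (restrict_space borel (sphere 0 1)) \<and> finite_measure \<nu>}"

text \<open>The moment problem with objective \<open>f 0\<close> and constraint polynomials \<open>f 1, ..., f m\<close>.\<close>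

definition gmp_feasible ::
  "nat \<Rightarrow> (nat \<Rightarrow> 'n::finite mpoly) \<Rightarrow> (nat \<Rightarrow> real) \<Rightarrow> (real ^ 'n) measure set" where
  "gmp_feasible m f b =
     {\<nu> \<in> sphere_measures. \<forall>i\<in>{1..m}. (LINT x|\<nu>. peval (f i) x) = b i}"

definition gmp_optimal ::
  "nat \<Rightarrow> (nat \<Rightarrow> 'n::finite mpoly) \<Rightarrow> (nat \<Rightarrow> real) \<Rightarrow> (real ^ 'n) measure \<Rightarrow> bool" where
  "gmp_optimal m f b \<nu> \<longleftrightarrow> \<nu> \<in> gmp_feasible m f b \<and>
     (\<forall>\<mu>\<in>gmp_feasible m f b. (LINT x|\<nu>. peval (f 0) x) \<le> (LINT x|\<mu>. peval (f 0) x))"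

text \<open>
  A real infimum: meaningful only if the problem is feasible and bounded below, in particular
  if it has an optimal solution.
\<close>

definition gmp_val ::
  "nat \<Rightarrow> (nat \<Rightarrow> 'n::finite mpoly) \<Rightarrow> (nat \<Rightarrow> real) \<Rightarrow> real" where
  "gmp_val m f b = (INF \<nu>\<in>gmp_feasible m f b. (LINT x|\<nu>. peval (f 0) x))"

end

theory Submission
  imports Defs
begin

text \<open>
  For a unit vector \<open>y\<close> the polynomial \<open>(1 + x \<bullet> y) ^ (2 * r)\<close> is a square of degree \<open>2 * r\<close>
  which, on the sphere, is concentrated near \<open>y\<close>.  Divided by its integral it is a probability
  density that mimics the point mass at \<open>y\<close>, so a measure with finitely many atoms is mimicked by
  a nonnegative combination of such squares.  The optimal measure is first replaced by an atomic
  one: partition the sphere into Borel pieces of radius at most \<open>1 / r\<close> and move the mass of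
  each piece to one point.  The polynomials are Lipschitz on the sphere, so this changes their
  integrals by \<open>O(1/r)\<close> (\<open>lipschitz_quadrature_on_sphere\<close>).

  What remains is that the normalised kernel reproduces \<open>f y\<close> up to \<open>O(1/r)\<close>, uniformly in \<open>y\<close>
  (\<open>kernel_approximates_point_evaluation\<close>).  A typical point of the kernel has distance of order
  \<open>r ^ (- 1/2)\<close> from \<open>y\<close>, so a Lipschitz bound would only give \<open>O(r ^ (- 1/2))\<close>.  A second order
  expansion of \<open>f\<close> at \<open>y\<close> does better: its tangential linear part integrates to \<open>0\<close>, because the
  reflection in the line through \<open>y\<close> preserves the kernel and the surface measure and changes the
  sign of tangent vectors.  All other terms are bounded by multiples of
  \<open>(norm (x - y))\<^sup>2 = 2 * (1 - x \<bullet> y)\<close>.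

  The mean of \<open>1 - x \<bullet> y\<close> under the kernel is \<open>O(1/r)\<close>.  Write \<open>t = x \<bullet> y\<close>.  Integration by parts
  on the unit sphere of an \<open>n\<close>-dimensional space, in the form that the integral of a rotated
  function does not depend on the angle of rotation, gives
  \<open>k * \<integral>(1 - t) * (1 + t) ^ k = (n - 1) * \<integral>t * (1 + t) ^ k\<close> (\<open>integral_sphere_one_minus\<close>),
  and \<open>t \<le> 1\<close> bounds the right-hand side by \<open>n * \<integral>(1 + t) ^ k\<close>.
\<close>

section \<open>Evaluation and degree of polynomials\<close>

lemma peval_eq_sum_superset:
  assumes "finite K" "Poly_Mapping.keys p \<subseteq> K"
  shows "peval p x = (\<Sum>a\<in>K. Poly_Mapping.lookup p a * (\<Prod>i\<in>UNIV. (x $ i) ^ Poly_Mapping.lookup a i))"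
  unfolding peval_def
  by (rule sum.mono_neutral_left) (use assms in \<open>auto simp: not_in_keys_iff_lookup_eq_zero\<close>)

lemma peval_zero [simp]: "peval 0 x = 0"
  by (simp add: peval_def)

lemma peval_single:
  "peval (Poly_Mapping.single a c) x = c * (\<Prod>i\<in>UNIV. (x $ i) ^ Poly_Mapping.lookup a i)"
  by (subst peval_eq_sum_superset[where K = "{a}"]) auto

lemma peval_add [simp]: "peval (p + q) x = peval p x + peval q x"
proof -
  let ?K = "Poly_Mapping.keys p \<union> Poly_Mapping.keys q"
  have "peval s x = (\<Sum>a\<in>?K. Poly_Mapping.lookup s a * (\<Prod>i\<in>UNIV. (x $ i) ^ Poly_Mapping.lookup a i))"
    if "s \<in> {p, q, p + q}" for s
    by (rule peval_eq_sum_superset) (use that keys_add[of p q] in auto)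
  then show ?thesis
    by (simp add: lookup_add distrib_right sum.distrib)
qed

lemma peval_sum [simp]: "peval (\<Sum>i\<in>I. p i) x = (\<Sum>i\<in>I. peval (p i) x)"
  by (induction I rule: infinite_finite_induct) auto

lemma poly_mapping_eq_sum_single:
  "p = (\<Sum>a\<in>Poly_Mapping.keys p. Poly_Mapping.single a (Poly_Mapping.lookup p a))"
  by (rule poly_mapping_eqI)
     (simp add: lookup_sum lookup_single when_def not_in_keys_iff_lookup_eq_zero)

lemma peval_mult [simp]: "peval (p * q) x = peval p x * peval q x"
proof -
  have mono: "peval (Poly_Mapping.single a c * Poly_Mapping.single b d) x =
      peval (Poly_Mapping.single a c) x * peval (Poly_Mapping.single b d) x" for a b c d
    by (simp add: mult_single peval_single lookup_add power_add prod.distrib)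
  let ?s = "\<lambda>p. (\<Sum>a\<in>Poly_Mapping.keys p. Poly_Mapping.single a (Poly_Mapping.lookup p a))"
  have "peval (?s p * ?s q) x = peval (?s p) x * peval (?s q) x"
    by (simp add: sum_product mono)
  then show ?thesis
    by (simp flip: poly_mapping_eq_sum_single)
qed

lemma peval_one [simp]: "peval 1 x = 1"
  using peval_single[of 0 1 x] by simp

lemma peval_power [simp]: "peval (p ^ k) x = peval p x ^ k"
  by (induction k) auto

lemma peval_const: "peval (Poly_Mapping.single 0 c) x = c"
  by (simp add: peval_single)

lemma peval_coordinate:
  "peval (Poly_Mapping.single (Poly_Mapping.single i 1) c) x = c * x $ i"
proof -
  have "(\<Prod>j\<in>UNIV. (x $ j) ^ Poly_Mapping.lookup (Poly_Mapping.single i 1) j) =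
      (\<Prod>j\<in>UNIV. if i = j then x $ j else 1)"
    by (rule prod.cong) (auto simp: lookup_single when_def)
  then show ?thesis
    by (simp add: peval_single)
qed

lemma total_degree_le_iff:
  "total_degree p \<le> d \<longleftrightarrow>
    (\<forall>a\<in>Poly_Mapping.keys p. (\<Sum>i\<in>UNIV. Poly_Mapping.lookup a i) \<le> d)"
  by (auto simp: total_degree_def)

lemma total_degree_zero [simp]: "total_degree 0 = 0"
  by (simp add: total_degree_def)

lemma total_degree_add_le:
  assumes "total_degree p \<le> d" "total_degree q \<le> d"
  shows "total_degree (p + q) \<le> d"
  using assms keys_add[of p q] unfolding total_degree_le_iff by blast

lemma total_degree_mult_le:
  assumes "total_degree p \<le> d" "total_degree q \<le> e"
  shows "total_degree (p * q) \<le> d + e"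
  unfolding total_degree_le_iff
proof
  fix c assume "c \<in> Poly_Mapping.keys (p * q)"
  then obtain a b where "c = a + b" "a \<in> Poly_Mapping.keys p" "b \<in> Poly_Mapping.keys q"
    using keys_mult[of p q] by blast
  with assms show "(\<Sum>i\<in>UNIV. Poly_Mapping.lookup c i) \<le> d + e"
    unfolding total_degree_le_iff by (auto simp: lookup_add sum.distrib intro!: add_mono)
qed

lemma total_degree_single_le:
  "total_degree (Poly_Mapping.single a c) \<le> (\<Sum>i\<in>UNIV. Poly_Mapping.lookup a i)"
  by (auto simp: total_degree_le_iff)

lemma total_degree_const [simp]: "total_degree (Poly_Mapping.single 0 c) = 0"
  using total_degree_single_le[of 0 c] by simp

lemma total_degree_one [simp]: "total_degree 1 = 0"
  using total_degree_const[of 1] by simp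

lemma total_degree_power_le:
  assumes "total_degree p \<le> d"
  shows "total_degree (p ^ k) \<le> k * d"
proof (induction k)
  case (Suc k)
  then show ?case
    using total_degree_mult_le[OF assms Suc] by simp
qed simp

lemma total_degree_sum_le:
  assumes "\<And>i. i \<in> I \<Longrightarrow> total_degree (p i) \<le> d"
  shows "total_degree (\<Sum>i\<in>I. p i) \<le> d"
  using assms by (induction I rule: infinite_finite_induct) (auto intro: total_degree_add_le)

definition affine_form :: "real ^ 'n \<Rightarrow> 'n::finite mpoly" where
  "affine_form y = 1 + (\<Sum>i\<in>UNIV. Poly_Mapping.single (Poly_Mapping.single i 1) (y $ i))"

lemma peval_affine_form: "peval (affine_form y) x = 1 + x \<bullet> y"
  by (simp only: affine_form_def peval_add peval_one peval_sum peval_coordinate)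
     (simp add: inner_vec_def mult.commute)

lemma total_degree_affine_form:
  fixes y :: "real ^ 'n::finite"
  shows "total_degree (affine_form y) \<le> 1"
  unfolding affine_form_def
proof (intro total_degree_add_le total_degree_sum_le)
  fix i :: 'n
  have "(\<Sum>j\<in>UNIV. Poly_Mapping.lookup (Poly_Mapping.single i (1::nat)) j) = 1"
    by (simp add: lookup_single when_def)
  then show "total_degree (Poly_Mapping.single (Poly_Mapping.single i 1) (y $ i)) \<le> 1"
    using total_degree_single_le[of "Poly_Mapping.single i 1" "y $ i"] by simp
qed simp

text \<open>
  A nonnegative coefficient is absorbed into its square through its square root.
\<close>

lemma nonneg_combination_of_squares_in_sos:
  fixes c :: "nat \<Rightarrow> real" and q :: "nat \<Rightarrow> 'n::finite mpoly"
  assumes "\<And>j. j < k \<Longrightarrow> 0 \<le> c j" "\<And>j. j < k \<Longrightarrow> total_degree (q j) \<le> r"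
  shows "\<exists>h\<in>sos r. \<forall>x. peval h x = (\<Sum>j<k. c j * (peval (q j) x)\<^sup>2)"
proof -
  define s where "s = (\<lambda>j. Poly_Mapping.single 0 (sqrt (c j)) * q j)"
  define h where "h = (\<Sum>j<k. s j * s j)"
  have "total_degree (s j * s j) \<le> 2 * r" if "j < k" for j
    using total_degree_mult_le[of "s j" r "s j" r]
      total_degree_mult_le[of "Poly_Mapping.single 0 (sqrt (c j))" 0 "q j" r] assms(2)[OF that]
    by (simp add: s_def)
  then have "total_degree h \<le> 2 * r"
    unfolding h_def by (intro total_degree_sum_le) auto
  moreover have "h = (\<Sum>p\<leftarrow>map s [0..<k]. p * p)"
    by (simp add: h_def comp_def interv_sum_list_conv_sum_set_nat atLeast0LessThan)
  ultimately have "h \<in> sos r"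
    unfolding sos_def by blast
  moreover have "peval h x = (\<Sum>j<k. c j * (peval (q j) x)\<^sup>2)" for x
  proof -
    have "peval (s j * s j) x = c j * (peval (q j) x)\<^sup>2" if "j < k" for j
      using assms(1)[OF that] by (simp add: s_def peval_const power2_eq_square flip: real_sqrt_mult)
    then show ?thesis
      unfolding h_def peval_sum by (intro sum.cong) auto
  qed
  ultimately show ?thesis by blast
qed

section \<open>Integration over the sphere\<close>

lemma sphere_measures_space: "\<mu> \<in> sphere_measures \<Longrightarrow> space \<mu> = sphere 0 1"
  using sets_eq_imp_space_eq[of \<mu> "restrict_space borel (sphere 0 1)"]
  by (simp add: sphere_measures_def space_restrict_space)

lemma sphere_measures_measurable:
  fixes f :: "'a::euclidean_space \<Rightarrow> real"
  assumes "\<mu> \<in> sphere_measures" "continuous_on (sphere 0 1) f"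
  shows "f \<in> borel_measurable \<mu>"
proof -
  have "sets \<mu> = sets (restrict_space borel (sphere 0 1))"
    using assms(1) by (simp add: sphere_measures_def)
  then show ?thesis
    using borel_measurable_continuous_on_restrict[OF assms(2)] measurable_cong_sets by blast
qed

lemma sphere_measures_integrable:
  fixes f :: "'a::euclidean_space \<Rightarrow> real"
  assumes "\<mu> \<in> sphere_measures" "continuous_on (sphere 0 1) f"
  shows "integrable \<mu> f"
proof -
  interpret finite_measure \<mu>
    using assms(1) by (simp add: sphere_measures_def)
  have "compact (f ` sphere 0 1)"
    by (intro compact_continuous_image assms(2) compact_sphere)
  then obtain B where "\<And>x. x \<in> sphere 0 1 \<Longrightarrow> norm (f x) \<le> B"
    by (metis compact_imp_bounded bounded_iff image_eqI)
  then have "AE x in \<mu>. norm (f x) \<le> B"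
    by (intro AE_I2) (use sphere_measures_space[OF assms(1)] in auto)
  then show ?thesis
    by (rule integrable_const_bound) (rule sphere_measures_measurable[OF assms])
qed

text \<open>
  Membership of a point in the cone over \<open>A\<close> depends on its direction only; as a preimage under
  \<open>sgn\<close> the cone is visibly Borel and compatible with orthogonal maps.
\<close>

lemma cone_eq_sgn_vimage:
  fixes A :: "'a::euclidean_space set"
  assumes "A \<subseteq> sphere 0 1"
  shows "{t *\<^sub>R a | t a. 0 < t \<and> t < 1 \<and> a \<in> A} = sgn -` A \<inter> (ball 0 1 - {0})"
proof (intro equalityI subsetI)
  fix x assume x: "x \<in> sgn -` A \<inter> (ball 0 1 - {0})"
  then have "x = norm x *\<^sub>R sgn x" "0 < norm x" "norm x < 1" "sgn x \<in> A"
    by (auto simp: sgn_div_norm)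
  then show "x \<in> {t *\<^sub>R a | t a. 0 < t \<and> t < 1 \<and> a \<in> A}" by blast
next
  fix x assume "x \<in> {t *\<^sub>R a | t a. 0 < t \<and> t < 1 \<and> a \<in> A}"
  then obtain t a where ta: "x = t *\<^sub>R a" "0 < t" "t < 1" "a \<in> A" by blast
  with assms have "norm a = 1" by auto
  with ta show "x \<in> sgn -` A \<inter> (ball 0 1 - {0})"
    by (auto simp: sgn_div_norm)
qed

lemma emeasure_sphere_measure':
  fixes A :: "'a::euclidean_space set"
  assumes "A \<in> sets borel" "A \<subseteq> sphere 0 1"
  shows "emeasure sphere_measure A =
    of_nat DIM('a) * emeasure lborel (sgn -` A \<inter> (ball 0 1 - {0}))"
  using emeasure_sphere_measure[OF assms] cone_eq_sgn_vimage[OF assms(2)] by simp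

lemma emeasure_sphere_measure_sphere:
  "emeasure sphere_measure (sphere (0::'a::euclidean_space) 1) =
    of_nat DIM('a) * emeasure lborel (ball (0::'a) 1)"
proof -
  have "sgn -` sphere (0::'a) 1 \<inter> (ball 0 1 - {0}) = ball 0 1 - {0}"
    by (auto simp: norm_sgn)
  moreover have "emeasure lborel (ball (0::'a) 1 - {0}) = emeasure lborel (ball (0::'a) 1)"
    by (rule emeasure_Diff_null_set) auto
  ultimately show ?thesis
    by (simp add: emeasure_sphere_measure')
qed

lemma sphere_measure_in_sphere_measures: "sphere_measure \<in> sphere_measures"
proof -
  have "emeasure sphere_measure (sphere (0::'a) 1) \<noteq> \<infinity>"
    unfolding emeasure_sphere_measure_sphere
    using emeasure_lborel_ball_finite[of "0::'a" 1] by (simp add: ennreal_mult_eq_top_iff less_top)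
  then show ?thesis
    by (simp add: sphere_measures_def sets_sphere_measure finite_measureI space_sphere_measure)
qed

lemma measure_sphere_pos: "0 < measure sphere_measure (sphere (0::'a::euclidean_space) 1)"
proof -
  have "0 < measure lborel (ball (0::'a) 1)"
    by (simp add: content_ball_pos)
  then show ?thesis
    by (simp add: measure_def emeasure_sphere_measure_sphere enn2real_mult)
qed

text \<open>
  An orthogonal map takes a ball to a ball of the same radius and hence of the same volume.  By
  Vitali's covering theorem an open set is, up to a null set, a countable disjoint union of balls,
  and linear maps preserve null sets.
\<close>

lemma emeasure_lborel_orthogonal_image_open:
  fixes T :: "'a::euclidean_space \<Rightarrow> 'a"
  assumes T: "orthogonal_transformation T" and U: "open U"
  shows "emeasure lborel (T ` U) = emeasure lborel U"
proof -
  have inj: "inj T" and lin: "linear T"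
    using T by (simp_all add: orthogonal_transformation_inj orthogonal_transformation_linear)
  have open_image: "open (T ` V)" if "open V" for V
    using open_surjective_linear_image[OF that lin] orthogonal_transformation_surj[OF T] by blast
  let ?K = "{(c, \<rho>). 0 < \<rho> \<and> ball c \<rho> \<subseteq> U}"
  obtain C where C: "countable C" "C \<subseteq> ?K"
    and disj: "pairwise (\<lambda>i j. disjnt (ball (fst i) (snd i)) (ball (fst j) (snd j))) C"
    and neg: "negligible (U - (\<Union>i\<in>C. ball (fst i) (snd i)))"
  proof (rule Vitali_covering_theorem_balls)
    fix x and d :: real
    assume x: "x \<in> U" "0 < d"
    then obtain \<rho> where \<rho>: "0 < \<rho>" "ball x \<rho> \<subseteq> U"
      using U open_contains_ball by blast
    with x have "(x, min \<rho> (d / 2)) \<in> ?K \<and> x \<in> ball x (min \<rho> (d / 2)) \<and> min \<rho> (d / 2) < d"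
      by (auto intro: subset_trans[OF subset_ball])
    then show "\<exists>i. i \<in> ?K \<and> x \<in> ball (fst i) (snd i) \<and> snd i < d"
      by (intro exI[of _ "(x, min \<rho> (d / 2))"]) simp
  qed
  define B where "B = (\<lambda>i :: 'a \<times> real. ball (fst i) (snd i))"
  define W where "W = (\<Union>i\<in>C. B i)"
  have "B i \<subseteq> U" if "i \<in> C" for i
    using subsetD[OF C(2) that] by (simp add: B_def case_prod_beta)
  then have W: "open W" "W \<subseteq> U"
    by (auto simp: W_def B_def)
  have TB: "T ` B i = ball (T (fst i)) (snd i)" for i
    by (simp add: B_def image_orthogonal_transformation_ball[OF T])
  have family: "disjoint_family_on B C"
    using disj by (auto simp: disjoint_family_on_def pairwise_def disjnt_def B_def)
  have "emeasure lborel (T ` W) = (\<integral>\<^sup>+i. emeasure lborel (T ` B i) \<partial>count_space C)"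
    unfolding W_def image_UN
  proof (rule emeasure_UN_countable)
    show "disjoint_family_on (\<lambda>i. T ` B i) C"
      using family by (simp add: disjoint_family_on_def flip: image_Int[OF inj])
  qed (use C(1) TB in auto)
  also have "\<dots> = (\<integral>\<^sup>+i. emeasure lborel (B i) \<partial>count_space C)"
  proof (rule nn_integral_cong)
    fix i assume "i \<in> space (count_space C)"
    then have "0 \<le> snd i"
      using C(2) by auto
    then show "emeasure lborel (T ` B i) = emeasure lborel (B i)"
      unfolding TB by (simp add: B_def emeasure_ball)
  qed
  also have "\<dots> = emeasure lborel W"
    unfolding W_def by (rule emeasure_UN_countable[symmetric]) (use C(1) family in \<open>auto simp: B_def\<close>)
  finally have TW: "emeasure lborel (T ` W) = emeasure lborel W" .
  have null: "U - W \<in> null_sets lborel"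
    using neg U W by (simp add: W_def B_def negligible_iff_null_sets null_sets_completion_iff)
  have "negligible (T ` (U - W))"
    using neg lin by (intro negligible_differentiable_image_negligible)
      (auto simp: W_def B_def linear_imp_differentiable_on)
  moreover have "T ` (U - W) = T ` U - T ` W"
    by (rule image_set_diff[OF inj])
  ultimately have null': "T ` U - T ` W \<in> null_sets lborel"
    using open_image[OF U] open_image[OF W(1)]
    by (simp add: negligible_iff_null_sets null_sets_completion_iff)
  have "T ` U = T ` W \<union> (T ` U - T ` W)" "U = W \<union> (U - W)"
    using W by auto
  then show ?thesis
    using TW emeasure_Un_null_set[OF _ null] emeasure_Un_null_set[OF _ null'] W open_image[OF W(1)]
    by (metis borel_open sets_lborel)
qed

lemma lborel_distr_orthogonal:
  fixes T :: "'a::euclidean_space \<Rightarrow> 'a"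
  assumes T: "orthogonal_transformation T"
  shows "distr lborel borel T = lborel"
proof (rule lborel_eqI[symmetric])
  fix l u :: 'a assume le: "\<And>b. b \<in> Basis \<Longrightarrow> l \<bullet> b \<le> u \<bullet> b"
  have [measurable]: "T \<in> borel_measurable borel"
    using T by (intro borel_measurable_continuous_onI linear_continuous_on)
      (simp add: linear_conv_bounded_linear[symmetric] orthogonal_transformation_linear)
  have "T -` box l u = inv T ` box l u"
    by (rule bij_vimage_eq_inv_image[OF orthogonal_transformation_bij[OF T]])
  then have "emeasure (distr lborel borel T) (box l u) = emeasure lborel (box l u)"
    using emeasure_lborel_orthogonal_image_open[OF orthogonal_transformation_inv[OF T] open_box]
    by (simp add: emeasure_distr)
  then show "emeasure (distr lborel borel T) (box l u) = (\<Prod>b\<in>Basis. (u - l) \<bullet> b)"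
    using le by simp
qed simp

text \<open>
  Orthogonal maps commute with \<open>sgn\<close> and preserve the punctured ball, so the invariance of
  Lebesgue measure passes to its radial projection.
\<close>

lemma distr_sphere_measure_orthogonal:
  fixes T :: "'a::euclidean_space \<Rightarrow> 'a"
  assumes T: "orthogonal_transformation T"
  shows "T \<in> sphere_measure \<rightarrow>\<^sub>M sphere_measure"
    and "distr sphere_measure sphere_measure T = sphere_measure"
proof -
  have lin: "linear T" and nT: "\<And>x. norm (T x) = norm x"
    using T by (simp_all add: orthogonal_transformation_linear orthogonal_transformation_norm)
  have contT: "continuous_on U T" for U
    using lin by (simp add: linear_continuous_on linear_conv_bounded_linear)
  have "T \<in> borel_measurable (restrict_space borel (sphere 0 1))"
    by (intro borel_measurable_continuous_on_restrict contT)
  then have "T \<in> restrict_space borel (sphere 0 1) \<rightarrow>\<^sub>M restrict_space borel (sphere 0 1)"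
    by (intro measurable_restrict_space2) (auto simp: space_restrict_space nT)
  then show meas: "T \<in> sphere_measure \<rightarrow>\<^sub>M sphere_measure"
    using measurable_cong_sets[OF sets_sphere_measure sets_sphere_measure] by blast
  show "distr sphere_measure sphere_measure T = sphere_measure"
  proof (rule measure_eqI)
    fix A assume "A \<in> sets (distr sphere_measure sphere_measure T)"
    then have A: "A \<in> sets sphere_measure" by simp
    have sub: "B \<in> sets borel \<and> B \<subseteq> sphere 0 1"
      if "B \<in> sets (sphere_measure :: 'a measure)" for B
      using that by (auto simp: sets_sphere_measure sets_restrict_space)
    let ?C = "\<lambda>B. sgn -` B \<inter> (ball 0 1 - {0}) :: 'a set"
    have pre: "T -` A \<inter> space sphere_measure = T -` A"
      using sub[OF A] nT by (auto simp: space_sphere_measure)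
    have A': "T -` A \<in> sets sphere_measure"
      using measurable_sets[OF meas A] by (simp add: pre)
    have "sgn \<in> borel_measurable (borel :: 'a measure)"
      unfolding sgn_div_norm by measurable
    from measurable_sets[OF this] have C_borel: "?C A \<in> sets borel"
      using sub[OF A] by auto
    have "sgn (T x) = T (sgn x)" for x
      by (simp add: sgn_div_norm nT linear_cmul[OF lin])
    moreover have "T x = 0 \<longleftrightarrow> x = 0" for x
      using nT[of x] by (metis norm_eq_zero)
    ultimately have preimage: "T -` ?C A = ?C (T -` A)"
      by (auto simp: nT)
    have "T \<in> borel_measurable lborel"
      using contT[of UNIV] by (simp add: borel_measurable_continuous_onI)
    then have "emeasure lborel (T -` ?C A) = emeasure (distr lborel borel T) (?C A)"
      using C_borel by (simp add: emeasure_distr)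
    then have "emeasure lborel (?C (T -` A)) = emeasure lborel (?C A)"
      by (simp only: lborel_distr_orthogonal[OF T] preimage)
    then have "emeasure sphere_measure (T -` A) = emeasure sphere_measure A"
      using sub[OF A'] sub[OF A] by (simp add: emeasure_sphere_measure')
    then show "emeasure (distr sphere_measure sphere_measure T) A = emeasure sphere_measure A"
      by (simp add: emeasure_distr[OF meas A] pre)
  qed simp
qed

lemma integral_sphere_measure_orthogonal:
  fixes T :: "'a::euclidean_space \<Rightarrow> 'a" and f :: "'a \<Rightarrow> real"
  assumes "orthogonal_transformation T" "continuous_on (sphere 0 1) f"
  shows "(LINT x|sphere_measure. f (T x)) = (LINT x|sphere_measure. f x)"
  using integral_distr[OF distr_sphere_measure_orthogonal(1)[OF assms(1)]
      sphere_measures_measurable[OF sphere_measure_in_sphere_measures assms(2)]]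
  by (simp add: distr_sphere_measure_orthogonal(2)[OF assms(1)])

section \<open>Concentration of the kernel\<close>

text \<open>
  Integration by parts for the rotations in the plane of \<open>y\<close> and \<open>e\<close>: differentiate the constant
  function that maps \<open>\<theta>\<close> to the integral of \<open>F (R \<theta> x)\<close>, where
  \<open>F x = (x \<bullet> e) * (1 + x \<bullet> y) ^ Suc k\<close> and \<open>R \<theta>\<close> rotates by the angle \<open>\<theta>\<close>.  The derivative of
  \<open>F (R \<theta> x)\<close> at \<open>\<theta> = 0\<close> is \<open>G x\<close>, and the integral of \<open>G\<close> is the difference of the two sides.
\<close>

lemma integral_sphere_cos_sin:
  fixes y e :: "real ^ 'n::finite"
  assumes y: "norm y = 1" and e: "norm e = 1" and ye: "y \<bullet> e = 0"
  shows "(LINT x|sphere_measure. (x \<bullet> y) * (1 + x \<bullet> y) ^ Suc k) =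
    Suc k * (LINT x|sphere_measure. (x \<bullet> e)\<^sup>2 * (1 + x \<bullet> y) ^ k)"
proof -
  note int = sphere_measures_integrable[OF sphere_measure_in_sphere_measures]
  have unit: "y \<bullet> y = 1" "e \<bullet> e = 1" "e \<bullet> y = 0"
    using y e ye by (auto simp: dot_square_norm inner_commute)
  define R where "R = (\<lambda>\<theta> x. x + ((cos \<theta> - 1) * (x \<bullet> y) - sin \<theta> * (x \<bullet> e)) *\<^sub>R y +
    ((cos \<theta> - 1) * (x \<bullet> e) + sin \<theta> * (x \<bullet> y)) *\<^sub>R e)"
  have Ry: "R \<theta> x \<bullet> y = cos \<theta> * (x \<bullet> y) - sin \<theta> * (x \<bullet> e)" for \<theta> x
    by (simp add: R_def inner_add_left unit algebra_simps)
  have Re: "R \<theta> x \<bullet> e = cos \<theta> * (x \<bullet> e) + sin \<theta> * (x \<bullet> y)" for \<theta> x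
    by (simp add: R_def inner_add_left unit ye algebra_simps)
  have "linear (R \<theta>)" for \<theta>
    by (rule linearI) (simp_all add: R_def inner_add_left algebra_simps scaleR_add_left)
  moreover have "norm (R \<theta> x) = norm x" for \<theta> x
  proof -
    have "R \<theta> x \<bullet> R \<theta> x = R \<theta> x \<bullet> x + ((cos \<theta> - 1) * (x \<bullet> y) - sin \<theta> * (x \<bullet> e)) * (R \<theta> x \<bullet> y) +
        ((cos \<theta> - 1) * (x \<bullet> e) + sin \<theta> * (x \<bullet> y)) * (R \<theta> x \<bullet> e)"
      by (simp add: R_def inner_add_right)
    moreover have "R \<theta> x \<bullet> x = x \<bullet> x + ((cos \<theta> - 1) * (x \<bullet> y) - sin \<theta> * (x \<bullet> e)) * (x \<bullet> y) +
        ((cos \<theta> - 1) * (x \<bullet> e) + sin \<theta> * (x \<bullet> y)) * (x \<bullet> e)"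
      by (simp add: R_def inner_add_left inner_commute[of y x] inner_commute[of e x])
    moreover have "q + ((c - 1) * a - s * b) * a + ((c - 1) * b + s * a) * b +
        ((c - 1) * a - s * b) * (c * a - s * b) + ((c - 1) * b + s * a) * (c * b + s * a) =
        q + (c\<^sup>2 + s\<^sup>2 - 1) * (a\<^sup>2 + b\<^sup>2)" for a b c s q :: real
      by (simp add: power2_eq_square algebra_simps)
    ultimately have "R \<theta> x \<bullet> R \<theta> x = x \<bullet> x +
        ((cos \<theta>)\<^sup>2 + (sin \<theta>)\<^sup>2 - 1) * ((x \<bullet> y)\<^sup>2 + (x \<bullet> e)\<^sup>2)"
      unfolding Ry Re by metis
    then show ?thesis
      by (simp add: norm_eq_sqrt_inner)
  qed
  ultimately have orth: "orthogonal_transformation (R \<theta>)" for \<theta>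
    by (simp add: orthogonal_transformation)
  define F where "F = (\<lambda>x. (x \<bullet> e) * (1 + x \<bullet> y) ^ Suc k)"
  define G where "G = (\<lambda>x. (x \<bullet> y) * (1 + x \<bullet> y) ^ Suc k - Suc k * ((x \<bullet> e)\<^sup>2 * (1 + x \<bullet> y) ^ k))"
  define B where "B = 2 ^ Suc k + real (Suc k) * 2 ^ k"
  have contF: "continuous_on U F" and contG: "continuous_on U G" for U
    unfolding F_def G_def by (intro continuous_intros)+
  have deriv: "((\<lambda>\<theta>. F (R \<theta> x)) has_real_derivative G (R \<theta> x)) (at \<theta> within U)" for \<theta> x U
  proof -
    have s: "((\<lambda>\<theta>. R \<theta> x \<bullet> e) has_real_derivative R \<theta> x \<bullet> y) (at \<theta> within U)"
      and t: "((\<lambda>\<theta>. 1 + R \<theta> x \<bullet> y) has_real_derivative - (R \<theta> x \<bullet> e)) (at \<theta> within U)"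
      unfolding Ry Re by (auto intro!: derivative_eq_intros)
    show ?thesis
      unfolding F_def G_def
      by (rule DERIV_cong[OF DERIV_mult[OF s DERIV_power_Suc[OF t, of k]]])
         (simp add: power2_eq_square algebra_simps)
  qed
  have R0: "R 0 x = x" for x
    by (simp add: R_def)
  have boundG: "\<bar>G x\<bar> \<le> B" if "norm x = 1" for x
  proof -
    have "\<bar>x \<bullet> y\<bar> \<le> 1" "\<bar>x \<bullet> e\<bar> \<le> 1"
      using Cauchy_Schwarz_ineq2[of x y] Cauchy_Schwarz_ineq2[of x e] that y e by auto
    then have "\<bar>(x \<bullet> y) * (1 + x \<bullet> y) ^ Suc k\<bar> \<le> 1 * 2 ^ Suc k"
      and "\<bar>(x \<bullet> e)\<^sup>2 * (1 + x \<bullet> y) ^ k\<bar> \<le> 1 * 2 ^ k"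
      unfolding abs_mult power_abs
      by (intro mult_mono power_mono power_le_one; force)+
    then have "\<bar>(x \<bullet> y) * (1 + x \<bullet> y) ^ Suc k\<bar> + Suc k * \<bar>(x \<bullet> e)\<^sup>2 * (1 + x \<bullet> y) ^ k\<bar> \<le> B"
      unfolding B_def by (intro add_mono mult_left_mono) auto
    moreover have "\<bar>G x\<bar> \<le> \<bar>(x \<bullet> y) * (1 + x \<bullet> y) ^ Suc k\<bar> + Suc k * \<bar>(x \<bullet> e)\<^sup>2 * (1 + x \<bullet> y) ^ k\<bar>"
      unfolding G_def by (rule order_trans[OF abs_triangle_ineq4]) (simp add: abs_mult)
    ultimately show ?thesis by linarith
  qed
  define h where "h = (\<lambda>j. inverse (real (Suc j)))"
  have h: "h j > 0" for j
    by (simp add: h_def)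
  define D where "D = (\<lambda>j x. (F (R (h j) x) - F x) / h j)"
  have contR: "continuous_on U (R \<theta>)" for U \<theta>
    unfolding R_def by (intro continuous_intros)
  have contFR: "continuous_on U (\<lambda>x. F (R \<theta> x))" for U \<theta>
    using continuous_on_compose2[OF contF contR] by blast
  have contD: "continuous_on U (D j)" for U j
    unfolding D_def using h[of j] by (intro continuous_intros contFR contF) auto
  have boundD: "\<bar>D j x\<bar> \<le> B" if "norm x = 1" for j x
  proof -
    obtain z where "F (R (h j) x) - F (R 0 x) = (h j - 0) * G (R z x)"
      using MVT2[of 0 "h j" "\<lambda>\<theta>. F (R \<theta> x)" "\<lambda>\<theta>. G (R \<theta> x)"] h deriv by blast
    then have "D j x = G (R z x)"
      using h[of j] by (simp add: D_def R0)
    then show ?thesis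
      using boundG orthogonal_transformation_norm[OF orth] that by metis
  qed
  \<comment> \<open>Dominated convergence differentiates under the integral sign, along the step sizes \<open>h j\<close>.\<close>
  have "(\<lambda>j. LINT x|sphere_measure. D j x) \<longlonglongrightarrow> (LINT x|sphere_measure. G x)"
  proof (rule integral_dominated_convergence)
    show "integrable sphere_measure (\<lambda>x :: real ^ 'n. B)"
      by (intro int continuous_intros)
    show "G \<in> borel_measurable sphere_measure" "\<And>j. D j \<in> borel_measurable sphere_measure"
      by (intro borel_measurable_integrable int contG contD)+
    show "AE x in sphere_measure. norm (D j x) \<le> B" for j
      using boundD by (intro AE_I2) (simp add: space_sphere_measure)
    show "AE x in sphere_measure. (\<lambda>j. D j x) \<longlonglongrightarrow> G x"
    proof (intro AE_I2)
      fix x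
      have 1: "((\<lambda>t. (F (R (0 + t) x) - F (R 0 x)) / t) \<longlongrightarrow> G (R 0 x)) (at 0)"
        using deriv[of x 0 UNIV] by (simp add: DERIV_def)
      have 2: "filterlim h (at 0) sequentially"
        unfolding h_def filterlim_at using LIMSEQ_inverse_real_of_nat by auto
      show "(\<lambda>j. D j x) \<longlonglongrightarrow> G x"
        using filterlim_compose[OF 1 2] by (simp add: D_def R0)
    qed
  qed
  moreover have "(LINT x|sphere_measure. D j x) = 0" for j
  proof -
    have "(LINT x|sphere_measure. D j x) =
        ((LINT x|sphere_measure. F (R (h j) x)) - (LINT x|sphere_measure. F x)) / h j"
      unfolding D_def by (simp add: int contFR contF)
    then show ?thesis
      by (simp add: integral_sphere_measure_orthogonal[OF orth contF])
  qed
  ultimately have "(LINT x|sphere_measure. G x) = 0"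
    by (simp add: LIMSEQ_const_iff)
  moreover have "(LINT x|sphere_measure. G x) =
      (LINT x|sphere_measure. (x \<bullet> y) * (1 + x \<bullet> y) ^ Suc k) -
      Suc k * (LINT x|sphere_measure. (x \<bullet> e)\<^sup>2 * (1 + x \<bullet> y) ^ k)"
    unfolding G_def
    by (subst Bochner_Integration.integral_diff) (auto intro!: int continuous_intros)
  ultimately show ?thesis by simp
qed

lemma obtain_orthonormal_frame:
  fixes y :: "real ^ 'n::finite"
  assumes "norm y = 1"
  obtains e :: "'n \<Rightarrow> real ^ 'n" and i0 where "e i0 = y" "\<And>i. norm (e i) = 1"
    "\<And>i j. i \<noteq> j \<Longrightarrow> e i \<bullet> e j = 0" "\<And>x. (\<Sum>i\<in>UNIV. (x \<bullet> e i)\<^sup>2) = x \<bullet> x"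
proof -
  define i0 where "i0 = (undefined :: 'n)"
  obtain T where T: "orthogonal_transformation T" "T (axis i0 (1::real)) = y"
    using orthogonal_transformation_exists_1[of "axis i0 (1::real)" y] assms by auto
  show thesis
  proof
    show "T (axis i0 1) = y" by (rule T)
    show "norm (T (axis i 1)) = 1" for i
      using T by (simp add: orthogonal_transformation_norm)
    show "T (axis i 1) \<bullet> T (axis j 1) = 0" if "i \<noteq> j" for i j
      using T that by (simp add: orthogonal_transformation_def inner_axis_axis)
    fix x
    obtain z where z: "x = T z"
      using orthogonal_transformation_surj[OF T(1)] by blast
    have "T z \<bullet> T (axis i 1) = z $ i" for i
      using T by (simp add: orthogonal_transformation_def inner_axis)
    moreover have "T z \<bullet> T z = z \<bullet> z"
      using T by (simp add: orthogonal_transformation_def)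
    ultimately show "(\<Sum>i\<in>UNIV. (x \<bullet> T (axis i 1))\<^sup>2) = x \<bullet> x"
      by (simp add: z inner_vec_def power2_eq_square)
  qed
qed

text \<open>
  Summing the previous identity over an orthonormal basis of the hyperplane orthogonal to \<open>y\<close>:
  on the sphere the squares \<open>(x \<bullet> e)\<^sup>2\<close> add up to \<open>1 - (x \<bullet> y)\<^sup>2\<close>, which contributes one more
  factor \<open>1 + x \<bullet> y\<close>.
\<close>

lemma integral_sphere_one_minus:
  fixes y :: "real ^ 'n::finite"
  assumes y: "norm y = 1"
  shows "Suc k * (LINT x|sphere_measure. (1 - x \<bullet> y) * (1 + x \<bullet> y) ^ Suc k) =
    real (CARD('n) - 1) * (LINT x|sphere_measure. (x \<bullet> y) * (1 + x \<bullet> y) ^ Suc k)"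
proof -
  note int = sphere_measures_integrable[OF sphere_measure_in_sphere_measures]
  obtain e :: "'n \<Rightarrow> real ^ 'n" and i0 where e: "e i0 = y" "\<And>i. norm (e i) = 1"
    "\<And>i j. i \<noteq> j \<Longrightarrow> e i \<bullet> e j = 0" "\<And>x. (\<Sum>i\<in>UNIV. (x \<bullet> e i)\<^sup>2) = x \<bullet> x"
    using obtain_orthonormal_frame[OF y] by blast
  have eq: "(1 - x \<bullet> y) * (1 + x \<bullet> y) ^ Suc k = (\<Sum>i\<in>UNIV - {i0}. (x \<bullet> e i)\<^sup>2 * (1 + x \<bullet> y) ^ k)"
    if "x \<in> sphere 0 1" for x
  proof -
    have "(\<Sum>i\<in>UNIV - {i0}. (x \<bullet> e i)\<^sup>2) = (1 - x \<bullet> y) * (1 + x \<bullet> y)"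
      using e(4)[of x] that
      by (simp add: sum.remove[of UNIV i0] e(1) dot_square_norm power2_eq_square algebra_simps)
    then show ?thesis
      by (simp add: mult.assoc flip: sum_distrib_right)
  qed
  have "Suc k * (LINT x|sphere_measure. (1 - x \<bullet> y) * (1 + x \<bullet> y) ^ Suc k) =
      Suc k * (LINT x|sphere_measure. (\<Sum>i\<in>UNIV - {i0}. (x \<bullet> e i)\<^sup>2 * (1 + x \<bullet> y) ^ k))"
    by (subst Bochner_Integration.integral_cong[OF refl eq]) (simp_all add: space_sphere_measure)
  also have "\<dots> = (\<Sum>i\<in>UNIV - {i0}. Suc k * (LINT x|sphere_measure. (x \<bullet> e i)\<^sup>2 * (1 + x \<bullet> y) ^ k))"
    by (subst Bochner_Integration.integral_sum)
       (auto intro!: int continuous_intros simp: sum_distrib_left)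
  also have "\<dots> = (\<Sum>i\<in>UNIV - {i0}. LINT x|sphere_measure. (x \<bullet> y) * (1 + x \<bullet> y) ^ Suc k)"
    by (intro sum.cong refl integral_sphere_cos_sin[symmetric] y e(2)) (use e(1,3) in auto)
  also have "\<dots> = real (card (UNIV - {i0})) * (LINT x|sphere_measure. (x \<bullet> y) * (1 + x \<bullet> y) ^ Suc k)"
    by simp
  finally show ?thesis
    by (simp only: card_Diff_singleton UNIV_I)
qed

text \<open>
  By Bernoulli's inequality the kernel is at least \<open>1 + 2 * r * (x \<bullet> y)\<close>, whose integral is the
  total surface area, as \<open>x \<bullet> y\<close> is odd.
\<close>

lemma integral_sphere_kernel_pos:
  fixes y :: "real ^ 'n::finite"
  shows "0 < (LINT x|sphere_measure. (1 + x \<bullet> y) ^ (2 * r))"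
proof -
  note int = sphere_measures_integrable[OF sphere_measure_in_sphere_measures]
  have "(LINT x|sphere_measure. x \<bullet> y) = (LINT x|sphere_measure. (- x) \<bullet> y)"
    by (rule integral_sphere_measure_orthogonal[symmetric])
       (auto intro!: continuous_intros simp: orthogonal_transformation_neg)
  then have odd: "(LINT x|sphere_measure. x \<bullet> y) = 0"
    by simp
  have "0 < measure sphere_measure (sphere (0 :: real ^ 'n) 1)"
    by (rule measure_sphere_pos)
  also have "\<dots> = (LINT x|sphere_measure. 1 + real (2 * r) * (x \<bullet> y))"
    by (subst Bochner_Integration.integral_add)
       (auto intro!: int continuous_intros simp: odd space_sphere_measure)
  also have "\<dots> \<le> (LINT x|sphere_measure. (1 + x \<bullet> y) ^ (2 * r))"
    by (intro integral_mono int continuous_intros Bernoulli_inequality_even) simp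
  finally show ?thesis .
qed

lemma integral_sphere_kernel_concentrated:
  fixes y :: "real ^ 'n::finite"
  assumes y: "norm y = 1" and r: "1 \<le> r"
  shows "(LINT x|sphere_measure. (1 - x \<bullet> y) * (1 + x \<bullet> y) ^ (2 * r)) \<le>
    real CARD('n) / real r * (LINT x|sphere_measure. (1 + x \<bullet> y) ^ (2 * r))"
    (is "?L \<le> _ * ?N")
proof -
  note int = sphere_measures_integrable[OF sphere_measure_in_sphere_measures]
  define k where "k = 2 * r - 1"
  have k: "2 * r = Suc k"
    using r by (simp add: k_def)
  have "(x \<bullet> y) * (1 + x \<bullet> y) ^ (2 * r) \<le> (1 + x \<bullet> y) ^ (2 * r)" if "x \<in> sphere 0 1" for x
  proof -
    have "x \<bullet> y \<le> 1"
      using Cauchy_Schwarz_ineq2[of x y] that y by auto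
    then show ?thesis
      using mult_right_mono[of "x \<bullet> y" 1 "(1 + x \<bullet> y) ^ (2 * r)"]
      by (simp add: zero_le_even_power)
  qed
  then have "(LINT x|sphere_measure. (x \<bullet> y) * (1 + x \<bullet> y) ^ (2 * r)) \<le> ?N"
    by (intro integral_mono int continuous_intros) (simp add: space_sphere_measure)
  then have "real (2 * r) * ?L \<le> real (CARD('n) - 1) * ?N"
    using integral_sphere_one_minus[OF y, of k] unfolding k by (simp add: mult_left_mono)
  also have "\<dots> \<le> real CARD('n) * (2 * ?N)"
    using integral_sphere_kernel_pos[of y r] by (intro mult_mono) auto
  finally have "real r * ?L \<le> real CARD('n) * ?N"
    by simp
  then show ?thesis
    using r by (simp add: field_simps)
qed

section \<open>Second order expansions on the sphere\<close>

text \<open>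
  Here \<open>g\<close> is the gradient of \<open>f\<close> or any substitute for it, and a single constant bounds \<open>f\<close>,
  \<open>g\<close> and the remainder, so that the class is closed under products with an explicit constant.
\<close>

definition second_order_on_sphere :: "real \<Rightarrow> ('a::euclidean_space \<Rightarrow> real) \<Rightarrow> bool" where
  "second_order_on_sphere C f \<longleftrightarrow> (\<exists>g. \<forall>x\<in>sphere 0 1. \<forall>y\<in>sphere 0 1.
     \<bar>f x\<bar> \<le> C \<and> norm (g y) \<le> C \<and> \<bar>f x - f y - g y \<bullet> (x - y)\<bar> \<le> C * (norm (x - y))\<^sup>2)"

lemma second_order_on_sphere_mono:
  assumes "second_order_on_sphere C f" "C \<le> D"
  shows "second_order_on_sphere D f"
proof -
  obtain g where g: "\<forall>x\<in>sphere 0 1. \<forall>y\<in>sphere 0 1.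
     \<bar>f x\<bar> \<le> C \<and> norm (g y) \<le> C \<and> \<bar>f x - f y - g y \<bullet> (x - y)\<bar> \<le> C * (norm (x - y))\<^sup>2"
    using assms(1) unfolding second_order_on_sphere_def by blast
  have "C * (norm (x - y))\<^sup>2 \<le> D * (norm (x - y))\<^sup>2" for x y :: 'a
    using assms(2) by (simp add: mult_right_mono)
  then have "\<bar>f x\<bar> \<le> D \<and> norm (g y) \<le> D \<and> \<bar>f x - f y - g y \<bullet> (x - y)\<bar> \<le> D * (norm (x - y))\<^sup>2"
    if "x \<in> sphere 0 1" "y \<in> sphere 0 1" for x y
    using g[rule_format, OF that] assms(2) order_trans by blast
  then show ?thesis
    unfolding second_order_on_sphere_def by blast
qed

lemma second_order_on_sphere_nonneg:
  fixes f :: "'a::euclidean_space \<Rightarrow> real"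
  assumes "second_order_on_sphere C f"
  shows "0 \<le> C"
proof -
  obtain b :: 'a where "b \<in> Basis"
    using nonempty_Basis by blast
  then have "b \<in> sphere 0 1" by simp
  then have "\<bar>f b\<bar> \<le> C"
    using assms unfolding second_order_on_sphere_def by blast
  then show ?thesis by linarith
qed

text \<open>
  Points of the sphere have distance at most \<open>2\<close>, so the quadratic remainder is at most
  \<open>2 * C * norm (x - y)\<close>; the linear part contributes another \<open>C * norm (x - y)\<close>.
\<close>

lemma second_order_on_sphere_lipschitz:
  fixes f :: "'a::euclidean_space \<Rightarrow> real"
  assumes f: "second_order_on_sphere C f"
  shows "(3 * C)-lipschitz_on (sphere 0 1) f"
proof (rule lipschitz_onI)
  have C: "0 \<le> C"
    using f by (rule second_order_on_sphere_nonneg)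
  then show "0 \<le> 3 * C" by simp
  fix x y :: 'a assume x: "x \<in> sphere 0 1" and y: "y \<in> sphere 0 1"
  obtain g where g: "norm (g y) \<le> C" "\<bar>f x - f y - g y \<bullet> (x - y)\<bar> \<le> C * (norm (x - y))\<^sup>2"
    using f x y unfolding second_order_on_sphere_def by blast
  have "norm (x - y) \<le> 2"
    using norm_triangle_ineq4[of x y] x y by simp
  then have "C * (norm (x - y))\<^sup>2 \<le> C * (2 * norm (x - y))"
    unfolding power2_eq_square using C by (intro mult_left_mono mult_right_mono) auto
  moreover have "\<bar>g y \<bullet> (x - y)\<bar> \<le> C * norm (x - y)"
    using Cauchy_Schwarz_ineq2[of "g y" "x - y"] g(1) by (smt (verit) mult_right_mono norm_ge_zero)
  ultimately show "dist (f x) (f y) \<le> 3 * C * dist x y"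
    using g(2) unfolding dist_norm real_norm_def by linarith
qed

lemma second_order_on_sphere_const: "second_order_on_sphere \<bar>c\<bar> (\<lambda>x. c)"
  unfolding second_order_on_sphere_def by (intro exI[of _ "\<lambda>_. 0"]) auto

lemma second_order_on_sphere_component: "second_order_on_sphere 1 (\<lambda>x :: real ^ 'n::finite. x $ i)"
  unfolding second_order_on_sphere_def
proof (intro exI[of _ "\<lambda>_. axis i 1"] ballI conjI)
  fix x y :: "real ^ 'n" assume "x \<in> sphere 0 1"
  then show "\<bar>x $ i\<bar> \<le> 1"
    using component_le_norm_cart[of x i] by simp
  have "x $ i - y $ i - axis i 1 \<bullet> (x - y) = 0"
    by (simp add: inner_axis')
  then show "\<bar>x $ i - y $ i - axis i 1 \<bullet> (x - y)\<bar> \<le> 1 * (norm (x - y))\<^sup>2"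
    by simp
qed simp

lemma second_order_on_sphere_add:
  assumes "second_order_on_sphere A f" "second_order_on_sphere B h"
  shows "second_order_on_sphere (A + B) (\<lambda>x. f x + h x)"
proof -
  obtain g where g: "\<And>x y. x \<in> sphere 0 1 \<Longrightarrow> y \<in> sphere 0 1 \<Longrightarrow> \<bar>f x\<bar> \<le> A \<and> norm (g y) \<le> A \<and>
      \<bar>f x - f y - g y \<bullet> (x - y)\<bar> \<le> A * (norm (x - y))\<^sup>2"
    using assms(1) unfolding second_order_on_sphere_def by blast
  obtain k where k: "\<And>x y. x \<in> sphere 0 1 \<Longrightarrow> y \<in> sphere 0 1 \<Longrightarrow> \<bar>h x\<bar> \<le> B \<and> norm (k y) \<le> B \<and>
      \<bar>h x - h y - k y \<bullet> (x - y)\<bar> \<le> B * (norm (x - y))\<^sup>2"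
    using assms(2) unfolding second_order_on_sphere_def by blast
  show ?thesis
    unfolding second_order_on_sphere_def
  proof (intro exI[of _ "\<lambda>y. g y + k y"] ballI conjI)
    fix x y :: 'a assume "x \<in> sphere 0 1" "y \<in> sphere 0 1"
    note g = g[OF this] and k = k[OF this]
    show "\<bar>f x + h x\<bar> \<le> A + B"
      using g k by linarith
    show "norm (g y + k y) \<le> A + B"
      using g k norm_triangle_mono by blast
    show "\<bar>f x + h x - (f y + h y) - (g y + k y) \<bullet> (x - y)\<bar> \<le> (A + B) * (norm (x - y))\<^sup>2"
      using g k unfolding inner_add_left distrib_right by linarith
  qed
qed

text \<open>
  Leibniz rule.  The remainder of the product consists of the two remainders, each weighted with a
  value of the other factor, and of \<open>(f x - f y) * (h x - h y)\<close>; these contribute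
  \<open>1\<close>, \<open>1\<close> and \<open>3 * 3\<close> to the factor \<open>11\<close>.
\<close>

lemma second_order_on_sphere_mult:
  assumes "second_order_on_sphere A f" "second_order_on_sphere B h"
  shows "second_order_on_sphere (11 * (A * B)) (\<lambda>x. f x * h x)"
proof -
  have A: "0 \<le> A" and B: "0 \<le> B"
    using assms second_order_on_sphere_nonneg by blast+
  obtain g where g: "\<And>x y. x \<in> sphere 0 1 \<Longrightarrow> y \<in> sphere 0 1 \<Longrightarrow> \<bar>f x\<bar> \<le> A \<and> norm (g y) \<le> A \<and>
      \<bar>f x - f y - g y \<bullet> (x - y)\<bar> \<le> A * (norm (x - y))\<^sup>2"
    using assms(1) unfolding second_order_on_sphere_def by blast
  obtain k where k: "\<And>x y. x \<in> sphere 0 1 \<Longrightarrow> y \<in> sphere 0 1 \<Longrightarrow> \<bar>h x\<bar> \<le> B \<and> norm (k y) \<le> B \<and>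
      \<bar>h x - h y - k y \<bullet> (x - y)\<bar> \<le> B * (norm (x - y))\<^sup>2"
    using assms(2) unfolding second_order_on_sphere_def by blast
  show ?thesis
    unfolding second_order_on_sphere_def
  proof (intro exI[of _ "\<lambda>y. f y *\<^sub>R k y + h y *\<^sub>R g y"] ballI conjI)
    fix x y :: 'a assume x: "x \<in> sphere 0 1" and y: "y \<in> sphere 0 1"
    define d where "d = (norm (x - y))\<^sup>2"
    have "\<bar>f x * h x\<bar> \<le> A * B"
      unfolding abs_mult using g[OF x y] k[OF x y] A by (intro mult_mono) auto
    then show "\<bar>f x * h x\<bar> \<le> 11 * (A * B)"
      using mult_nonneg_nonneg[OF A B] by linarith
    have "norm (f y *\<^sub>R k y) \<le> A * B" "norm (h y *\<^sub>R g y) \<le> B * A"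
      unfolding norm_scaleR using g[OF y y] k[OF y y] A B by (auto intro!: mult_mono)
    then have "norm (f y *\<^sub>R k y + h y *\<^sub>R g y) \<le> A * B + B * A"
      by (rule norm_triangle_mono)
    then show "norm (f y *\<^sub>R k y + h y *\<^sub>R g y) \<le> 11 * (A * B)"
      using mult_nonneg_nonneg[OF A B] by (simp add: mult.commute[of B A])
    have 1: "\<bar>f y * (h x - h y - k y \<bullet> (x - y))\<bar> \<le> A * (B * d)"
      unfolding abs_mult d_def using g[OF y y] k[OF x y] A by (intro mult_mono) auto
    have 2: "\<bar>h y * (f x - f y - g y \<bullet> (x - y))\<bar> \<le> B * (A * d)"
      unfolding abs_mult d_def using k[OF y y] g[OF x y] B by (intro mult_mono) auto
    have 3: "\<bar>(f x - f y) * (h x - h y)\<bar> \<le> (3 * A * norm (x - y)) * (3 * B * norm (x - y))"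
      unfolding abs_mult
      using A lipschitz_onD[OF second_order_on_sphere_lipschitz[OF assms(1)] x y]
        lipschitz_onD[OF second_order_on_sphere_lipschitz[OF assms(2)] x y]
      by (intro mult_mono) (auto simp: dist_norm)
    have "f x * h x - f y * h y - (f y *\<^sub>R k y + h y *\<^sub>R g y) \<bullet> (x - y) =
        f y * (h x - h y - k y \<bullet> (x - y)) + h y * (f x - f y - g y \<bullet> (x - y)) +
        (f x - f y) * (h x - h y)"
      by (simp add: inner_add_left algebra_simps)
    moreover have "A * (B * d) + B * (A * d) + (3 * A * norm (x - y)) * (3 * B * norm (x - y)) =
        11 * (A * B) * d"
      by (simp add: d_def power2_eq_square algebra_simps)
    ultimately show "\<bar>f x * h x - f y * h y - (f y *\<^sub>R k y + h y *\<^sub>R g y) \<bullet> (x - y)\<bar>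
        \<le> 11 * (A * B) * (norm (x - y))\<^sup>2"
      using 1 2 3 unfolding d_def by linarith
  qed
qed

lemma second_order_on_sphere_peval:
  fixes p :: "'n::finite mpoly"
  shows "\<exists>C. second_order_on_sphere C (peval p)"
proof -
  have sum: "\<exists>C. second_order_on_sphere C (\<lambda>x. \<Sum>i\<in>I. F i x)"
    if "\<And>i. i \<in> I \<Longrightarrow> \<exists>C. second_order_on_sphere C (F i)" "finite I"
    for I :: "'b set" and F :: "'b \<Rightarrow> real ^ 'n \<Rightarrow> real"
    using that(2,1)
  proof (induction I rule: finite_induct)
    case empty
    show ?case
      using second_order_on_sphere_const[of 0] by auto
  next
    case (insert i I)
    then obtain A B where "second_order_on_sphere A (F i)"
        "second_order_on_sphere B (\<lambda>x. \<Sum>i\<in>I. F i x)"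
      by blast
    then show ?case
      unfolding sum.insert[OF insert(1,2)] using second_order_on_sphere_add by blast
  qed
  have prod: "\<exists>C. second_order_on_sphere C (\<lambda>x. \<Prod>i\<in>I. F i x)"
    if "\<And>i. i \<in> I \<Longrightarrow> \<exists>C. second_order_on_sphere C (F i)" "finite I"
    for I :: "'b set" and F :: "'b \<Rightarrow> real ^ 'n \<Rightarrow> real"
    using that(2,1)
  proof (induction I rule: finite_induct)
    case empty
    show ?case
      using second_order_on_sphere_const[of 1] by auto
  next
    case (insert i I)
    then obtain A B where "second_order_on_sphere A (F i)"
        "second_order_on_sphere B (\<lambda>x. \<Prod>i\<in>I. F i x)"
      by blast
    then show ?case
      unfolding prod.insert[OF insert(1,2)] using second_order_on_sphere_mult by blast
  qed
  have power: "\<exists>C. second_order_on_sphere C (\<lambda>x :: real ^ 'n. (x $ i) ^ k)" for i k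
    using prod[of "{..<k}" "\<lambda>_ x. x $ i"] second_order_on_sphere_component by auto
  have "\<exists>C. second_order_on_sphere C (\<lambda>x. c * (\<Prod>i\<in>UNIV. (x $ i) ^ Poly_Mapping.lookup a i))"
    for c :: real and a :: "'n \<Rightarrow>\<^sub>0 nat"
  proof -
    obtain B where "second_order_on_sphere B (\<lambda>x :: real ^ 'n. \<Prod>i\<in>UNIV. (x $ i) ^ Poly_Mapping.lookup a i)"
      using prod[of UNIV "\<lambda>i x. (x $ i) ^ Poly_Mapping.lookup a i"] power by auto
    from second_order_on_sphere_mult[OF second_order_on_sphere_const this] show ?thesis
      by blast
  qed
  then show ?thesis
    unfolding peval_def by (intro sum finite_keys)
qed

section \<open>Approximation of point evaluations\<close>

lemma reflection_through_unit_vector: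
  fixes y :: "'a::euclidean_space"
  assumes "norm y = 1"
  shows "orthogonal_transformation (\<lambda>x. (2 * (x \<bullet> y)) *\<^sub>R y - x)"
  unfolding orthogonal_transformation_def
proof (intro conjI allI)
  show "linear (\<lambda>x. (2 * (x \<bullet> y)) *\<^sub>R y - x)"
    by (rule linearI) (simp_all add: inner_add_left algebra_simps)
  have "y \<bullet> y = 1"
    using assms by (simp add: dot_square_norm)
  then show "((2 * (v \<bullet> y)) *\<^sub>R y - v) \<bullet> ((2 * (w \<bullet> y)) *\<^sub>R y - w) = v \<bullet> w" for v w
    by (simp add: inner_diff_left inner_diff_right inner_commute algebra_simps)
qed

text \<open>
  In \<open>x - y = (x - (x \<bullet> y) *\<^sub>R y) - (1 - x \<bullet> y) *\<^sub>R y\<close> the first part is tangential, and its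
  contribution \<open>u\<close> to the integral vanishes by reflection.  The second part contributes at most
  \<open>C * (1 - x \<bullet> y)\<close>, and the remainder at most \<open>C * (norm (x - y))\<^sup>2 = 2 * C * (1 - x \<bullet> y)\<close>.
\<close>

lemma kernel_approximates_point_evaluation:
  fixes f :: "real ^ 'n::finite \<Rightarrow> real"
  assumes f: "second_order_on_sphere C f"
    and y: "norm y = 1" and r: "1 \<le> r"
  shows "\<bar>(LINT x|sphere_measure. f x * (1 + x \<bullet> y) ^ (2 * r)) -
      f y * (LINT x|sphere_measure. (1 + x \<bullet> y) ^ (2 * r))\<bar>
    \<le> 3 * C * real CARD('n) / real r * (LINT x|sphere_measure. (1 + x \<bullet> y) ^ (2 * r))"
    (is "\<bar>?I - f y * ?N\<bar> \<le> _")
proof -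
  note int = sphere_measures_integrable[OF sphere_measure_in_sphere_measures]
  let ?K = "\<lambda>x. (1 + x \<bullet> y) ^ (2 * r)"
  obtain g where "\<forall>x\<in>sphere 0 1. \<forall>y\<in>sphere 0 1. \<bar>f x\<bar> \<le> C \<and> norm (g y) \<le> C \<and>
      \<bar>f x - f y - g y \<bullet> (x - y)\<bar> \<le> C * (norm (x - y))\<^sup>2"
    using f unfolding second_order_on_sphere_def by blast
  then have gy: "norm (g y) \<le> C"
    and rem: "\<And>x. x \<in> sphere 0 1 \<Longrightarrow> \<bar>f x - f y - g y \<bullet> (x - y)\<bar> \<le> C * (norm (x - y))\<^sup>2"
    using y by auto
  have contf: "continuous_on (sphere 0 1) f"
    using second_order_on_sphere_lipschitz[OF f] by (rule lipschitz_on_continuous_on)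
  have C: "0 \<le> C"
    using f by (rule second_order_on_sphere_nonneg)
  have yy: "y \<bullet> y = 1"
    using y by (simp add: dot_square_norm)
  define u where "u = (\<lambda>x. g y \<bullet> (x - (x \<bullet> y) *\<^sub>R y) * ?K x)"
  have contu: "continuous_on U u" for U
    unfolding u_def by (intro continuous_intros)
  have "u ((2 * (x \<bullet> y)) *\<^sub>R y - x) = - u x" for x
    by (simp add: u_def inner_diff_left inner_diff_right yy algebra_simps)
  then have "(LINT x|sphere_measure. - u x) = (LINT x|sphere_measure. u x)"
    using integral_sphere_measure_orthogonal[OF reflection_through_unit_vector[OF y] contu]
    by simp
  then have u0: "(LINT x|sphere_measure. u x) = 0"
    by simp
  have bound: "\<bar>(f x - f y) * ?K x - u x\<bar> \<le> 3 * C * ((1 - x \<bullet> y) * ?K x)"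
    if x: "x \<in> sphere 0 1" for x
  proof -
    have le: "x \<bullet> y \<le> 1"
      using Cauchy_Schwarz_ineq2[of x y] x y by auto
    have "(norm (x - y))\<^sup>2 = 2 * (1 - x \<bullet> y)"
      using dot_norm_neg[of x y] x y by simp
    then have 1: "\<bar>f x - f y - g y \<bullet> (x - y)\<bar> \<le> 2 * C * (1 - x \<bullet> y)"
      using rem[OF x] by (simp add: mult_ac)
    have "\<bar>(1 - x \<bullet> y) * (g y \<bullet> y)\<bar> \<le> (1 - x \<bullet> y) * C"
      unfolding abs_mult using le Cauchy_Schwarz_ineq2[of "g y" y] y gy
      by (intro mult_mono) auto
    moreover have "(f x - f y) - g y \<bullet> (x - (x \<bullet> y) *\<^sub>R y) =
        (f x - f y - g y \<bullet> (x - y)) - (1 - x \<bullet> y) * (g y \<bullet> y)"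
      by (simp add: inner_diff_right algebra_simps)
    ultimately have "\<bar>(f x - f y) - g y \<bullet> (x - (x \<bullet> y) *\<^sub>R y)\<bar> \<le> 3 * C * (1 - x \<bullet> y)"
      using 1 by (simp add: algebra_simps)
    moreover have K: "0 \<le> ?K x"
      by (simp add: zero_le_even_power)
    ultimately have "\<bar>(f x - f y) - g y \<bullet> (x - (x \<bullet> y) *\<^sub>R y)\<bar> * ?K x \<le> 3 * C * (1 - x \<bullet> y) * ?K x"
      by (intro mult_right_mono)
    moreover have "(f x - f y) * ?K x - u x = ((f x - f y) - g y \<bullet> (x - (x \<bullet> y) *\<^sub>R y)) * ?K x"
      by (simp add: u_def left_diff_distrib)
    ultimately show ?thesis
      using K by (simp add: abs_mult mult.assoc)
  qed
  have "?I - f y * ?N = (LINT x|sphere_measure. (f x - f y) * ?K x)"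
    unfolding left_diff_distrib
    by (subst Bochner_Integration.integral_diff) (auto intro!: int continuous_intros contf)
  also have "\<dots> = (LINT x|sphere_measure. (f x - f y) * ?K x - u x)"
    by (subst Bochner_Integration.integral_diff) (auto intro!: int continuous_intros contu contf simp: u0)
  finally have "\<bar>?I - f y * ?N\<bar> \<le> (LINT x|sphere_measure. \<bar>(f x - f y) * ?K x - u x\<bar>)"
    using integral_abs_bound by metis
  also have "\<dots> \<le> (LINT x|sphere_measure. 3 * C * ((1 - x \<bullet> y) * ?K x))"
    using bound by (intro integral_mono int continuous_intros contu contf) (auto simp: space_sphere_measure)
  also have "\<dots> = 3 * C * (LINT x|sphere_measure. (1 - x \<bullet> y) * ?K x)"
    by simp
  also have "\<dots> \<le> 3 * C * (real CARD('n) / real r * ?N)"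
    using C by (intro mult_left_mono integral_sphere_kernel_concentrated[OF y r]) auto
  finally show ?thesis
    by (simp add: mult_ac)
qed

section \<open>Discretising the optimal measure\<close>

text \<open>
  Cover the sphere by finitely many balls of radius \<open>\<delta>\<close> with centres \<open>Y j\<close>, make them disjoint,
  and give \<open>Y j\<close> the mass \<open>w j\<close> of the \<open>j\<close>-th piece.  The nodes and weights serve all Lipschitz
  functions simultaneously, as is needed to meet several moment constraints with one measure.
\<close>

lemma lipschitz_quadrature_on_sphere:
  fixes \<mu> :: "'a::euclidean_space measure"
  assumes \<mu>: "\<mu> \<in> sphere_measures" and \<delta>: "0 < \<delta>"
  obtains k :: nat and Y :: "nat \<Rightarrow> 'a" and w :: "nat \<Rightarrow> real"
  where "\<And>j. j < k \<Longrightarrow> Y j \<in> sphere 0 1" "\<And>j. 0 \<le> w j"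
    "(\<Sum>j<k. w j) = measure \<mu> (sphere 0 1)"
    "\<And>f L. L-lipschitz_on (sphere 0 1) f \<Longrightarrow>
      \<bar>(LINT x|\<mu>. f x) - (\<Sum>j<k. w j * f (Y j))\<bar> \<le> L * \<delta> * measure \<mu> (sphere 0 1)"
proof -
  interpret finite_measure \<mu>
    using \<mu> by (simp add: sphere_measures_def)
  have space: "space \<mu> = sphere 0 1"
    using \<mu> by (rule sphere_measures_space)
  note int = sphere_measures_integrable[OF \<mu>]
  obtain Z where Z: "finite Z" "Z \<subseteq> sphere (0 :: 'a) 1" "sphere 0 1 \<subseteq> (\<Union>z\<in>Z. ball z \<delta>)"
    using compactE_image[OF compact_sphere[of "0 :: 'a" 1], of "sphere 0 1" "\<lambda>z. ball z \<delta>"] \<delta>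
    by force
  then obtain zs where zs: "set zs = Z"
    using finite_list by blast
  define k where "k = length zs"
  define Y where "Y = (\<lambda>j. zs ! j)"
  define A where "A = disjointed (\<lambda>j. ball (Y j) \<delta> \<inter> sphere 0 1)"
  define w where "w = (\<lambda>j. measure \<mu> (A j))"
  have Y: "Y j \<in> sphere 0 1" if "j < k" for j
    using that Z(2) zs nth_mem unfolding Y_def k_def by blast
  have A_sub: "A j \<subseteq> ball (Y j) \<delta> \<inter> sphere 0 1" for j
    unfolding A_def by (rule disjointed_subset)
  have sets: "sets \<mu> = sets (restrict_space borel (sphere 0 1))"
    using \<mu> by (simp add: sphere_measures_def)
  have "range (\<lambda>j. ball (Y j) \<delta> \<inter> sphere 0 1) \<subseteq> sets \<mu>"
    by (auto simp: sets sets_restrict_space)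
  then have A_meas: "A j \<in> sets \<mu>" for j
    unfolding A_def using sets.range_disjointed_sets by blast
  have A_disj: "disjoint_family A"
    unfolding A_def by (rule disjoint_family_disjointed)
  have "(\<Union>j<k. A j) = (\<Union>j<k. ball (Y j) \<delta> \<inter> sphere 0 1)"
    unfolding A_def lessThan_atLeast0 by (rule finite_UN_disjointed_eq)
  also have "\<dots> = (\<Union>z\<in>Z. ball z \<delta> \<inter> sphere 0 1)"
    by (simp add: Y_def k_def zs[symmetric] set_conv_nth[of zs]) blast
  finally have A_cover: "(\<Union>j<k. A j) = sphere 0 1"
    using Z(3) by auto
  have total: "(\<Sum>j<k. w j) = measure \<mu> (sphere 0 1)"
    unfolding w_def A_cover[symmetric]
    using A_meas A_disj by (intro finite_measure_finite_Union[symmetric]) (auto simp: disjoint_family_on_def)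
  show thesis
  proof (rule that)
    show "Y j \<in> sphere 0 1" if "j < k" for j
      by (rule Y[OF that])
    show "0 \<le> w j" for j
      by (simp add: w_def)
    show "(\<Sum>j<k. w j) = measure \<mu> (sphere 0 1)"
      by (rule total)
    fix f :: "'a \<Rightarrow> real" and L
    assume f: "L-lipschitz_on (sphere 0 1) f"
    have contf: "continuous_on (sphere 0 1) f"
      using f by (rule lipschitz_on_continuous_on)
    define s where "s = (\<lambda>x. \<Sum>j<k. f (Y j) * indicator (A j) x)"
    have int_ind: "integrable \<mu> (\<lambda>x. f (Y j) * indicator (A j) x)" for j
      using A_meas by (intro integrable_mult_right) (simp add: emeasure_finite less_top[symmetric])
    have int_s: "integrable \<mu> s"
      unfolding s_def using int_ind by (intro Bochner_Integration.integrable_sum)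
    have s_eq: "(LINT x|\<mu>. s x) = (\<Sum>j<k. w j * f (Y j))"
      unfolding s_def using int_ind A_meas
      by (subst Bochner_Integration.integral_sum) (auto simp: w_def mult.commute)
    have close: "\<bar>f x - s x\<bar> \<le> L * \<delta>" if x: "x \<in> sphere 0 1" for x
    proof -
      obtain j where j: "j < k" "x \<in> A j"
        using A_cover x by blast
      have "x \<notin> A i" if "i \<noteq> j" for i
        using A_disj j(2) that by (auto simp: disjoint_family_on_def)
      then have "s x = (\<Sum>i<k. if i = j then f (Y i) else 0)"
        unfolding s_def using j(2) by (intro sum.cong) auto
      also have "\<dots> = f (Y j)"
        using j(1) by simp
      finally have "\<bar>f x - s x\<bar> \<le> L * dist x (Y j)"
        using lipschitz_onD[OF f x Y[OF j(1)]] by (simp add: dist_norm)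
      also have "\<dots> \<le> L * \<delta>"
        using A_sub[of j] j(2) lipschitz_on_nonneg[OF f]
        by (intro mult_left_mono) (auto simp: dist_commute)
      finally show ?thesis .
    qed
    have "\<bar>(LINT x|\<mu>. f x) - (LINT x|\<mu>. s x)\<bar> = \<bar>LINT x|\<mu>. f x - s x\<bar>"
      using int[OF contf] int_s by simp
    also have "\<dots> \<le> (LINT x|\<mu>. \<bar>f x - s x\<bar>)"
      by (rule integral_abs_bound)
    also have "\<dots> \<le> (LINT x|\<mu>. L * \<delta>)"
      using int[OF contf] int_s close by (intro integral_mono) (auto simp: space)
    also have "\<dots> = L * \<delta> * measure \<mu> (sphere 0 1)"
      by (simp add: space)
    finally show "\<bar>(LINT x|\<mu>. f x) - (\<Sum>j<k. w j * f (Y j))\<bar> \<le> L * \<delta> * measure \<mu> (sphere 0 1)"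
      by (simp add: s_eq)
  qed
qed

section \<open>Sums of squares approximating a measure\<close>

text \<open>
  Quadrature with mesh \<open>1 / r\<close>, followed by the replacement of each atom by its normalised kernel.
  Both errors are proportional to the total mass of \<open>\<nu>\<close>.
\<close>

lemma sos_density_approximates_measure:
  fixes \<nu> :: "(real ^ 'n::finite) measure"
  assumes \<nu>: "\<nu> \<in> sphere_measures" and r: "1 \<le> r"
  obtains h where "h \<in> sos r"
    "\<And>C f. second_order_on_sphere C f \<Longrightarrow>
        \<bar>(LINT x|sphere_measure. f x * peval h x) - (LINT x|\<nu>. f x)\<bar>
        \<le> 3 * C * real (CARD('n) + 1) * measure \<nu> (sphere 0 1) / real r"
proof -
  note int = sphere_measures_integrable[OF sphere_measure_in_sphere_measures]
  have mesh: "0 < 1 / real r"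
    using r by simp
  obtain k Y and w :: "nat \<Rightarrow> real" where Y: "\<And>j. j < k \<Longrightarrow> Y j \<in> sphere 0 1"
    and w: "\<And>j. 0 \<le> w j" and total: "(\<Sum>j<k. w j) = measure \<nu> (sphere 0 1)"
    and quad: "\<And>f L. L-lipschitz_on (sphere 0 1) f \<Longrightarrow>
      \<bar>(LINT x|\<nu>. f x) - (\<Sum>j<k. w j * f (Y j))\<bar> \<le> L * (1 / real r) * measure \<nu> (sphere 0 1)"
    by (rule lipschitz_quadrature_on_sphere[OF \<nu> mesh], rule that)
  let ?K = "\<lambda>j x. (1 + x \<bullet> Y j) ^ (2 * r)"
  define N where "N = (\<lambda>j. LINT x|sphere_measure. ?K j x)"
  have N: "0 < N j" for j
    unfolding N_def by (rule integral_sphere_kernel_pos)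
  have "0 \<le> w j / N j" for j
    using w N[of j] by simp
  moreover have "total_degree (affine_form (Y j) ^ r) \<le> r" for j
    using total_degree_power_le[OF total_degree_affine_form] by simp
  ultimately obtain h where h: "h \<in> sos r"
    and h_eq: "\<And>x. peval h x = (\<Sum>j<k. w j / N j * (peval (affine_form (Y j) ^ r) x)\<^sup>2)"
    using nonneg_combination_of_squares_in_sos[of k "\<lambda>j. w j / N j" "\<lambda>j. affine_form (Y j) ^ r" r]
    by auto
  have h_kernel: "peval h x = (\<Sum>j<k. w j / N j * ?K j x)" for x
    unfolding h_eq by (simp add: peval_affine_form power_mult mult.commute[of 2] flip: power_mult)
  show thesis
  proof (rule that[OF h])
    fix C and f :: "real ^ 'n \<Rightarrow> real"
    assume f: "second_order_on_sphere C f"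
    have contf: "continuous_on (sphere 0 1) f"
      using second_order_on_sphere_lipschitz[OF f] by (rule lipschitz_on_continuous_on)
    let ?I = "\<lambda>j. LINT x|sphere_measure. f x * ?K j x"
    let ?D = "3 * C * real CARD('n) / real r"
    have "(LINT x|sphere_measure. f x * peval h x) =
        (LINT x|sphere_measure. (\<Sum>j<k. w j / N j * (f x * ?K j x)))"
      by (simp add: h_kernel sum_distrib_left mult_ac)
    also have "\<dots> = (\<Sum>j<k. w j / N j * ?I j)"
      by (subst Bochner_Integration.integral_sum) (auto intro!: int continuous_intros contf simp: less_imp_neq[OF N, symmetric])
    finally have "(LINT x|sphere_measure. f x * peval h x) - (\<Sum>j<k. w j * f (Y j)) =
        (\<Sum>j<k. w j / N j * ?I j - w j * f (Y j))"
      by (simp add: sum_subtractf)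
    also have "\<bar>\<dots>\<bar> \<le> (\<Sum>j<k. w j * ?D)"
    proof (rule order_trans[OF sum_abs sum_mono])
      fix j assume "j \<in> {..<k}"
      then have "norm (Y j) = 1"
        using Y[of j] by simp
      then have "\<bar>?I j - f (Y j) * N j\<bar> \<le> ?D * N j"
        unfolding N_def by (rule kernel_approximates_point_evaluation[OF f _ r])
      then have "w j / N j * \<bar>?I j - f (Y j) * N j\<bar> \<le> w j / N j * (?D * N j)"
        using w N[of j] by (intro mult_left_mono) auto
      moreover have "w j / N j * ?I j - w j * f (Y j) = w j / N j * (?I j - f (Y j) * N j)"
        using N[of j] by (simp add: field_simps)
      ultimately show "\<bar>w j / N j * ?I j - w j * f (Y j)\<bar> \<le> w j * ?D"
        using w[of j] N[of j] by (simp add: abs_mult)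
    qed
    finally have 1: "\<bar>(LINT x|sphere_measure. f x * peval h x) - (\<Sum>j<k. w j * f (Y j))\<bar>
        \<le> measure \<nu> (sphere 0 1) * ?D"
      by (simp only: total flip: sum_distrib_right)
    have 2: "\<bar>(LINT x|\<nu>. f x) - (\<Sum>j<k. w j * f (Y j))\<bar>
        \<le> 3 * C * (1 / real r) * measure \<nu> (sphere 0 1)"
      by (rule quad[OF second_order_on_sphere_lipschitz[OF f]])
    have "measure \<nu> (sphere 0 1) * ?D + 3 * C * (1 / real r) * measure \<nu> (sphere 0 1) =
        3 * C * real (CARD('n) + 1) * measure \<nu> (sphere 0 1) / real r"
      using r by (simp add: field_simps)
    with 1 2 show "\<bar>(LINT x|sphere_measure. f x * peval h x) - (LINT x|\<nu>. f x)\<bar>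
        \<le> 3 * C * real (CARD('n) + 1) * measure \<nu> (sphere 0 1) / real r"
      by linarith
  qed
qed

lemma gmp_val_eq_optimal:
  assumes "gmp_optimal m f b \<nu>"
  shows "gmp_val m f b = (LINT x|\<nu>. peval (f 0) x)"
  unfolding gmp_val_def
  by (rule cInf_eq_minimum) (use assms in \<open>auto simp: gmp_optimal_def\<close>)

theorem corollary1:
  fixes f :: "nat \<Rightarrow> 'n::finite mpoly" and b :: "nat \<Rightarrow> real" and m :: nat
  assumes "CARD('n) \<ge> 2"
    and "\<exists>\<nu>. gmp_optimal m f b \<nu>"
  shows "\<exists>C>0. \<forall>r\<ge>1. \<exists>h\<in>sos r.
    \<bar>(LINT x|sphere_measure. peval (f 0) x * peval h x) - gmp_val m f b\<bar> \<le> C / real r \<and>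
    (\<forall>i\<in>{1..m}. \<bar>(LINT x|sphere_measure. peval (f i) x * peval h x) - b i\<bar> \<le> C / real r)"
proof -
  obtain \<nu> where opt: "gmp_optimal m f b \<nu>"
    using assms(2) by blast
  then have \<nu>: "\<nu> \<in> sphere_measures" and moments: "\<And>i. i \<in> {1..m} \<Longrightarrow> (LINT x|\<nu>. peval (f i) x) = b i"
    by (auto simp: gmp_optimal_def gmp_feasible_def)
  obtain B where B: "\<And>i. second_order_on_sphere (B i) (peval (f i))"
    using choice[of "\<lambda>i C. second_order_on_sphere C (peval (f i))"] second_order_on_sphere_peval by blast
  \<comment> \<open>One constant for all the polynomials involved, so that the final bound is uniform in the index.\<close>
  define D where "D = (\<Sum>i\<le>m. B i)"
  have B_nonneg: "0 \<le> B i" for i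
    using B second_order_on_sphere_nonneg by blast
  have D: "second_order_on_sphere D (peval (f i))" if "i \<le> m" for i
    using B[of i]
  proof (rule second_order_on_sphere_mono)
    show "B i \<le> D"
      unfolding D_def using that B_nonneg by (intro member_le_sum) auto
  qed
  \<comment> \<open>The summand 1 only makes the constant positive when the measure or all polynomials vanish.\<close>
  define C where "C = 3 * D * real (CARD('n) + 1) * measure \<nu> (sphere 0 1) + 1"
  have "0 \<le> D"
    unfolding D_def using B_nonneg by (intro sum_nonneg)
  then have "0 < C"
    unfolding C_def by (intro add_nonneg_pos mult_nonneg_nonneg) auto
  moreover have "\<exists>h\<in>sos r.
      \<bar>(LINT x|sphere_measure. peval (f 0) x * peval h x) - gmp_val m f b\<bar> \<le> C / real r \<and>
      (\<forall>i\<in>{1..m}. \<bar>(LINT x|sphere_measure. peval (f i) x * peval h x) - b i\<bar> \<le> C / real r)"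
    if r: "1 \<le> r" for r
  proof -
    obtain h where h: "h \<in> sos r" and approx:
      "\<And>C f. second_order_on_sphere C f \<Longrightarrow>
        \<bar>(LINT x|sphere_measure. f x * peval h x) - (LINT x|\<nu>. f x)\<bar>
        \<le> 3 * C * real (CARD('n) + 1) * measure \<nu> (sphere 0 1) / real r"
      using sos_density_approximates_measure[OF \<nu> r] by blast
    have "3 * D * real (CARD('n) + 1) * measure \<nu> (sphere 0 1) / real r \<le> C / real r"
      unfolding C_def by (intro divide_right_mono) auto
    then have close: "\<bar>(LINT x|sphere_measure. peval (f i) x * peval h x) - (LINT x|\<nu>. peval (f i) x)\<bar>
        \<le> C / real r" if "i \<le> m" for i
      using approx[OF D[OF that]] by linarith
    show ?thesis
    proof (intro bexI[OF _ h] conjI ballI)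
      show "\<bar>(LINT x|sphere_measure. peval (f 0) x * peval h x) - gmp_val m f b\<bar> \<le> C / real r"
        using close[of 0] by (simp add: gmp_val_eq_optimal[OF opt])
      show "\<bar>(LINT x|sphere_measure. peval (f i) x * peval h x) - b i\<bar> \<le> C / real r"
        if "i \<in> {1..m}" for i
        using close[of i] moments[OF that] that by simp
    qed
  qed
  ultimately show ?thesis by blast
qed

end
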